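(* For each of the triplets $(e,e,13)$, $(e,12,e)$, $(e,12,12)$, $(e,12,13)$, $(e,12,23)$, $(e,12,123)$, $(e,12,132)$, $(e,13,13)$, $(e,23,13)$, $(e,123,13)$, $(e,132,13)$, the maximal entry $m_n$ of level $n$ of the associated TRIP-Stern tree satisfies, for all $n\ge 0$, $$m_n=\frac{2^{-n-1}\left(\left(\sqrt5-3\right)\left(1-\sqrt5\right)^n+\left(3+\sqrt5\right)\left(1+\sqrt5\right)^n\right)}{\sqrt5},$$ and consequently $m_n=m_{n-1}+m_{n-2}$ for $n\ge2$.
   Context: Let $A_0=\begin{pmatrix}0&0&1\\1&0&0\\0&1&1\end{pmatrix}$, $A_1=\begin{pmatrix}1&0&1\\0&1&0\\0&0&1\end{pmatrix}$. Elements of $S_3$ are identified with permutation matrices: $e=I$, $(12)=\begin{pmatrix}0&1&0\\1&0&0\\0&0&1\end{pmatrix}$, $(13)=\begin{pmatrix}0&0&1\\0&1&0\\1&0&0\end{pmatrix}$, $(23)=\begin{pmatrix}1&0&0\\0&0&1\\0&1&0\end{pmatrix}$, $(123)=\begin{pmatrix}0&1&0\\0&0&1\\1&0&0\end{pmatrix}$, $(132)=\begin{pmatrix}0&0&1\\1&0&0\\0&1&0\end{pmatrix}$. For $(\sigma,\tau_0,\tau_1)\in S_3^3$ put $F_0=\sigma A_0\tau_0$, $F_1=\sigma A_1\tau_1$. For $v=(i_1,\dots,i_n)\in\{0,1\}^n$ let $\triangle(v)=(1,1,1)F_{i_1}\cdots F_{i_n}=(b_1(v),b_2(v),b_3(v))$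 (row vector times matrices). The maximal entry of level $n$ is $m_n=\max_{|v|=n}\max_i b_i(v)$, $n\ge0$. *)

theory Defs
  imports "HOL-Analysis.Analysis"
begin

text \<open>All matrices are written as vectors of rows, so \<open>M $ i $ j\<close> is the entry in row \<open>i\<close>, column \<open>j\<close>.\<close>

definition A0 :: "int ^ 3 ^ 3" where
  "A0 = vector [vector [0, 0, 1], vector [1, 0, 0], vector [0, 1, 1]]"

definition A1 :: "int ^ 3 ^ 3" where
  "A1 = vector [vector [1, 0, 1], vector [0, 1, 0], vector [0, 0, 1]]"

text \<open>Elements of \<open>S\<^sub>3\<close> are identified with permutation matrices: the matrix of a permutation
  \<open>\<pi>\<close> (given in cycle notation) has in row \<open>i\<close> its entry 1 in column \<open>\<pi> i\<close>.\<close>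

definition perm_e :: "int ^ 3 ^ 3" where
  "perm_e = mat 1"

definition perm_12 :: "int ^ 3 ^ 3" where
  "perm_12 = vector [vector [0, 1, 0], vector [1, 0, 0], vector [0, 0, 1]]"

definition perm_13 :: "int ^ 3 ^ 3" where
  "perm_13 = vector [vector [0, 0, 1], vector [0, 1, 0], vector [1, 0, 0]]"

definition perm_23 :: "int ^ 3 ^ 3" where
  "perm_23 = vector [vector [1, 0, 0], vector [0, 0, 1], vector [0, 1, 0]]"

definition perm_123 :: "int ^ 3 ^ 3" where
  "perm_123 = vector [vector [0, 1, 0], vector [0, 0, 1], vector [1, 0, 0]]"

definition perm_132 :: "int ^ 3 ^ 3" where
  "perm_132 = vector [vector [0, 0, 1], vector [1, 0, 0], vector [0, 1, 0]]"

type_synonym triplet = "(int ^ 3 ^ 3) \<times> (int ^ 3 ^ 3) \<times> (int ^ 3 ^ 3)"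

text \<open>The matrices \<open>F\<^sub>0\<close> and \<open>F\<^sub>1\<close>; only the indices 0 and 1 are ever used.\<close>

fun F :: "triplet \<Rightarrow> nat \<Rightarrow> int ^ 3 ^ 3" where
  "F (\<sigma>, \<tau>0, \<tau>1) i = (if i = 0 then \<sigma> ** A0 ** \<tau>0 else \<sigma> ** A1 ** \<tau>1)"

definition words :: "nat \<Rightarrow> nat list set" where
  "words n = {v. set v \<subseteq> {0, 1} \<and> length v = n}"

definition triangle :: "triplet \<Rightarrow> nat list \<Rightarrow> int ^ 3" where
  "triangle t v = vector [1, 1, 1] v* foldr (\<lambda>i M. F t i ** M) v (mat 1)"

definition max_entry :: "triplet \<Rightarrow> nat \<Rightarrow> int" where
  "max_entry t n = (MAX v\<in>words n. MAX i\<in>UNIV. triangle t v $ i)"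

end

theory Submission
  imports Defs "HOL-Number_Theory.Fib"
begin

text \<open>In every step of the tree, two entries of a node survive and the third one is replaced by a
  sum of two entries, up to a permutation. Hence, for all permutations, the entries on level \<open>n\<close>
  are at most \<open>fib (n + 2)\<close> and the sums of two of them at most \<open>fib (n + 3)\<close>, by induction. For the
  eleven triplets we have \<open>\<sigma> = e\<close>, and \<open>\<tau>\<^sub>0 = (12)\<close> or \<open>\<tau>\<^sub>1 = (13)\<close>; the word \<open>00\<dots>0\<close> or
  \<open>11\<dots>1\<close>, respectively, then attains the bound.\<close>

lemma triangle_Nil: "triangle t [] = vector [1, 1, 1]"
  by (simp add: triangle_def)

lemma triangle_snoc: "triangle t (v @ [i]) = triangle t v v* F t i"
proof -
  \<comment> \<open>Moving the last letter out of the word changes the seed of the fold from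
    \<open>mat 1\<close> to \<open>F t i\<close>, so the seed is generalised to
    \<open>N\<close>.\<close>
  have "foldr (\<lambda>i M. F t i ** M) v N = foldr (\<lambda>i M. F t i ** M) v (mat 1) ** N" for N
    by (induction v) (simp_all add: matrix_mul_assoc)
  then have "foldr (\<lambda>i M. F t i ** M) (v @ [i]) (mat 1) =
      foldr (\<lambda>i M. F t i ** M) v (mat 1) ** F t i"
    by simp
  then show ?thesis
    by (simp only: triangle_def vector_matrix_mul_assoc)
qed

lemma vector_matrix_mult_3:
  fixes x :: "int ^ 3"
  shows "(x v* M) $ j = x $ 1 * M $ 1 $ j + x $ 2 * M $ 2 $ j + x $ 3 * M $ 3 $ j"
  by (simp add: vector_matrix_mult_def sum_3 mult.commute)

definition perm_mats :: "(int ^ 3 ^ 3) set" where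
  "perm_mats = {perm_e, perm_12, perm_13, perm_23, perm_123, perm_132}"

text \<open>The bound on pairs makes the induction work: a new entry is a sum of two distinct old
  ones, and bounding these separately would only give doubling.\<close>

definition fib_bounded :: "nat \<Rightarrow> int ^ 3 \<Rightarrow> bool" where
  "fib_bounded n x \<longleftrightarrow>
     (\<forall>i. x $ i \<le> int (fib (n + 2))) \<and> (\<forall>i j. i \<noteq> j \<longrightarrow> x $ i + x $ j \<le> int (fib (n + 3)))"

lemma fib_bounded_3:
  "fib_bounded n x \<longleftrightarrow>
     x $ 1 \<le> int (fib (n + 2)) \<and> x $ 2 \<le> int (fib (n + 2)) \<and> x $ 3 \<le> int (fib (n + 2)) \<and>
     x $ 1 + x $ 2 \<le> int (fib (n + 3)) \<and> x $ 1 + x $ 3 \<le> int (fib (n + 3)) \<and>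
     x $ 2 + x $ 3 \<le> int (fib (n + 3))"
  by (auto simp: fib_bounded_def forall_3 add.commute)

lemma fib_bounded_perm:
  assumes "fib_bounded n x" and "M \<in> perm_mats"
  shows "fib_bounded n (x v* M)"
  using assms unfolding perm_mats_def fib_bounded_3 vector_matrix_mult_3
  by (auto simp: perm_e_def perm_12_def perm_13_def perm_23_def perm_123_def perm_132_def mat_def
      add.commute)

text \<open>The product is \<open>(x2, x3, x1 + x3)\<close>. A pair containing the new entry is one
  old entry plus a sum of two distinct old ones, so it is at most
  \<open>fib (n + 2) + fib (n + 3) = fib (n + 4)\<close>. The same estimate works for
  \<open>A1\<close>, with product \<open>(x1, x2, x1 + x3)\<close>.\<close>

lemma fib_bounded_A0: "fib_bounded n x \<Longrightarrow> fib_bounded (Suc n) (x v* A0)"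
  unfolding fib_bounded_3 vector_matrix_mult_3 A0_def
  by (simp add: numeral_eq_Suc)

lemma fib_bounded_A1: "fib_bounded n x \<Longrightarrow> fib_bounded (Suc n) (x v* A1)"
  unfolding fib_bounded_3 vector_matrix_mult_3 A1_def
  by (simp add: numeral_eq_Suc)

lemma fib_bounded_F:
  assumes "fib_bounded n x" and "\<sigma> \<in> perm_mats" "\<tau>0 \<in> perm_mats" "\<tau>1 \<in> perm_mats"
  shows "fib_bounded (Suc n) (x v* F (\<sigma>, \<tau>0, \<tau>1) i)"
  using assms
  by (auto simp: fib_bounded_perm fib_bounded_A0 fib_bounded_A1
      simp flip: vector_matrix_mul_assoc)

lemma fib_bounded_triangle:
  assumes "\<sigma> \<in> perm_mats" "\<tau>0 \<in> perm_mats" "\<tau>1 \<in> perm_mats"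
  shows "fib_bounded (length v) (triangle (\<sigma>, \<tau>0, \<tau>1) v)"
proof (induction v rule: rev_induct)
  case Nil
  then show ?case
    \<comment> \<open>The root meets both bounds with equality: \<open>fib 2 = 1\<close> and
      \<open>fib 3 = 2\<close>.\<close>
    by (simp add: triangle_Nil fib_bounded_3 numeral_eq_Suc)
next
  case (snoc i v)
  then show ?case
    using assms by (simp add: triangle_snoc fib_bounded_F del: F.simps)
qed

text \<open>One step sends \<open>(a, b, c)\<close> to \<open>(c, b, a + c)\<close>: the middle
  entry stays fixed and the outer two run through the Fibonacci recurrence.\<close>

lemma triangle_replicate_0:
  "triangle (perm_e, perm_12, \<tau>1) (replicate n 0) =
     vector [int (fib (n + 1)), 1, int (fib (n + 2))]"
proof (induction n)
  case 0
  then show ?case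
    by (simp add: triangle_Nil numeral_eq_Suc)
next
  case (Suc n)
  have "replicate (Suc n) 0 = replicate n (0::nat) @ [0]"
    by (simp add: replicate_append_same)
  then show ?case
    by (simp only: triangle_snoc Suc.IH)
      (simp add: vec_eq_iff forall_3 vector_matrix_mult_3 A0_def perm_e_def perm_12_def
        flip: vector_matrix_mul_assoc)
qed

text \<open>Mirror image of the previous case: one step sends \<open>(a, b, c)\<close> to
  \<open>(a + c, b, a)\<close>.\<close>

lemma triangle_replicate_1:
  "triangle (perm_e, \<tau>0, perm_13) (replicate n 1) =
     vector [int (fib (n + 2)), 1, int (fib (n + 1))]"
proof (induction n)
  case 0
  then show ?case
    by (simp add: triangle_Nil numeral_eq_Suc)
next
  case (Suc n)
  have "replicate (Suc n) 1 = replicate n (1::nat) @ [1]"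
    by (simp add: replicate_append_same)
  then show ?case
    by (simp only: triangle_snoc Suc.IH)
      (simp add: vec_eq_iff forall_3 vector_matrix_mult_3 A1_def perm_e_def perm_13_def
        flip: vector_matrix_mul_assoc)
qed

lemma max_entry_eqI:
  assumes "\<And>v i. v \<in> words n \<Longrightarrow> triangle t v $ i \<le> m"
    and "v \<in> words n" "triangle t v $ i = m"
  shows "max_entry t n = m"
proof -
  have fin: "finite (words n)"
    unfolding words_def by (rule finite_lists_length_eq) simp
  have "(MAX i\<in>UNIV. triangle t w $ i) \<le> m" if "w \<in> words n" for w
    using assms(1) that by simp
  moreover have "m \<le> (MAX i\<in>UNIV. triangle t v $ i)"
    using assms(3) by (metis Max_ge finite finite_imageI rangeI)
  ultimately show ?thesis
    unfolding max_entry_def using fin assms(2)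
    by (intro Max_eqI) (auto intro!: image_eqI[of _ _ v] antisym)
qed

text \<open>The hypotheses describe exactly the eleven triplets: six with \<open>perm_12\<close> in
  the second place, six with \<open>perm_13\<close> in the third, one of them shared.\<close>

lemma max_entry_eq_fib:
  assumes "\<tau>0 \<in> perm_mats" "\<tau>1 \<in> perm_mats" and "\<tau>0 = perm_12 \<or> \<tau>1 = perm_13"
  shows "max_entry (perm_e, \<tau>0, \<tau>1) n = int (fib (n + 2))"
proof -
  have "perm_e \<in> perm_mats"
    by (simp add: perm_mats_def)
  then have le: "triangle (perm_e, \<tau>0, \<tau>1) v $ i \<le> int (fib (n + 2))" if "v \<in> words n" for v i
    using fib_bounded_triangle[OF _ assms(1,2)] that
    unfolding fib_bounded_def words_def by blast
  show ?thesis
    using assms(3)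
  proof
    assume "\<tau>0 = perm_12"
    then have "triangle (perm_e, \<tau>0, \<tau>1) (replicate n 0) $ 3 = int (fib (n + 2))"
      by (simp add: triangle_replicate_0)
    moreover have "replicate n 0 \<in> words n"
      by (auto simp: words_def)
    ultimately show ?thesis
      using le max_entry_eqI by blast
  next
    assume "\<tau>1 = perm_13"
    then have "triangle (perm_e, \<tau>0, \<tau>1) (replicate n 1) $ 1 = int (fib (n + 2))"
      by (simp add: triangle_replicate_1 del: One_nat_def)
    moreover have "replicate n 1 \<in> words n"
      by (auto simp: words_def)
    ultimately show ?thesis
      using le max_entry_eqI by blast
  qed
qed

text \<open>Binet's formula with the square of each base split off; its minus sign turns
  \<open>3 - sqrt 5\<close> into \<open>sqrt 5 - 3\<close>.\<close>

lemma fib_add_2_closed_form: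
  "real (fib (n + 2)) =
     2 powi (- int n - 1) *
       ((sqrt 5 - 3) * (1 - sqrt 5) ^ n + (3 + sqrt 5) * (1 + sqrt 5) ^ n) / sqrt 5"
proof -
  have "((1 + sqrt 5) / 2)\<^sup>2 = (3 + sqrt 5) / 2" "((1 - sqrt 5) / 2)\<^sup>2 = (3 - sqrt 5) / 2"
    by (simp_all add: power2_eq_square field_simps)
  then have powers: "((1 + sqrt 5) / 2) ^ (n + 2) = (3 + sqrt 5) * (1 + sqrt 5) ^ n / 2 ^ Suc n"
    "((1 - sqrt 5) / 2) ^ (n + 2) = (3 - sqrt 5) * (1 - sqrt 5) ^ n / 2 ^ Suc n"
    by (simp_all only: power_add) (simp_all add: power_divide mult.commute)
  have "- int n - 1 = - int (Suc n)"
    by simp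
  then have scale: "(2::real) powi (- int n - 1) = 1 / 2 ^ Suc n"
    by (simp only: power_int_minus power_int_of_nat inverse_eq_divide)
  show ?thesis
    unfolding fib_closed_form powers scale by (simp add: field_simps)
qed

theorem theorem12:
  fixes t :: triplet
  assumes "t \<in> {(perm_e, perm_e, perm_13),
                (perm_e, perm_12, perm_e),
                (perm_e, perm_12, perm_12),
                (perm_e, perm_12, perm_13),
                (perm_e, perm_12, perm_23),
                (perm_e, perm_12, perm_123),
                (perm_e, perm_12, perm_132),
                (perm_e, perm_13, perm_13),
                (perm_e, perm_23, perm_13),
                (perm_e, perm_123, perm_13),
                (perm_e, perm_132, perm_13)}"
  shows "(\<forall>n. real_of_int (max_entry t n) =
            2 powi (- int n - 1) *
              ((sqrt 5 - 3) * (1 - sqrt 5) ^ n + (3 + sqrt 5) * (1 + sqrt 5) ^ n) / sqrt 5)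
       \<and> (\<forall>n\<ge>2. max_entry t n = max_entry t (n - 1) + max_entry t (n - 2))"
proof -
  have "max_entry t n = int (fib (n + 2))" for n
    using assms by (auto simp: max_entry_eq_fib perm_mats_def)
  moreover have "fib (n + 2) = fib (n - 1 + 2) + fib (n - 2 + 2)" if ge: "n \<ge> 2" for n
  proof -
    \<comment> \<open>This substitution removes the truncated subtractions and leaves the recurrence
      of \<open>fib\<close>.\<close>
    obtain k where "n = 2 + k"
      using le_Suc_ex[OF ge] by blast
    then show ?thesis
      by (simp add: numeral_eq_Suc)
  qed
  ultimately show ?thesis
    using fib_add_2_closed_form by simp
qed

end
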